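(* Let $W:(0,+\infty)\to(0,+\infty)$ be the Lambert $W$ function. For $p\in(-1,0]$ put $C(p)=-2\sqrt{-p}+1$, and let $$D_1=\{(p,q)\in\mathbb{R}^2 : -\infty<p\le -1,\ p\le q<+\infty\},$$ $$D_2=\{(p,q)\in\mathbb{R}^2 : -1<p\le 0,\ C(p)\le q<+\infty\},$$ $$D_3=\{(p,q)\in\mathbb{R}^2 : 0\le p<+\infty,\ -\infty<q\le p\}.$$ Then for $p,q\in\mathbb{R}$, the function $W$ is strictly $H_{p,q}$-convex on $(0,+\infty)$ if and only if $(p,q)\in D_1\cup D_2$, and $W$ is strictly $H_{p,q}$-concave on $(0,+\infty)$ if and only if $(p,q)\in D_3$. In particular, for all $x,y\in(0,+\infty)$, $$W\left(\frac{2xy}{x+y}\right)\le\frac{2W(x)W(y)}{W(x)+W(y)},$$ and $$W\left(\left(\frac{2\sqrt[4]{xy}}{\sqrt[4]{x}+\sqrt[4]{y}}\right)^4\right)\le\sqrt{W(x)W(y)}\le W(\sqrt{xy})\le \frac12\left(W(x)+W(y)\right),$$ where equality holds in each of these inequalities if and only if $x=y$.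
   Context: The Lambert $W$ function is the real principal branch of the solution of $W(z)e^{W(z)}=z$; on $(0,+\infty)$, $W(x)$ is the unique positive real number with $W(x)e^{W(x)}=x$. For $r,s\in(0,+\infty)$ and $p\in\mathbb{R}$, the Hölder mean of order $p$ is $H_p(r,s)=\left(\frac{r^p+s^p}{2}\right)^{1/p}$ for $p\neq 0$, and $H_0(r,s)=\sqrt{rs}$. A function $f:(0,+\infty)\to(0,+\infty)$ is called $H_{p,q}$-convex (respectively $H_{p,q}$-concave) if $f(H_p(r,s))\le H_q(f(r),f(s))$ (respectively $f(H_p(r,s))\ge H_q(f(r),f(s))$) for all $r,s\in(0,+\infty)$. It is strictly $H_{p,q}$-convex (respectively strictly $H_{p,q}$-concave) if moreover the inequality is strict except for $r=s$. *)

theory Defs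
  imports Complex_Main
begin

text \<open>The principal branch, restricted to the positive half-line; the value is unspecified
  for \<open>x \<le> 0\<close>.\<close>

definition Lambert_W :: "real \<Rightarrow> real" where
  "Lambert_W x = (THE w. w > 0 \<and> w * exp w = x)"

lemma Lambert_W_ex1:
  fixes x :: real
  assumes "x > 0"
  shows "\<exists>!w. w > 0 \<and> w * exp w = x"
proof -
  have "\<exists>w\<ge>0. w \<le> x \<and> w * exp w = x"
    by (rule IVT) (use assms in \<open>auto intro!: continuous_intros\<close>)
  then obtain w where w: "w \<ge> 0" "w * exp w = x" by blast
  have "w > 0" using w assms by (cases "w = 0") auto
  moreover have "v = w" if "v > 0" "v * exp v = x" for v
  proof (rule ccontr)
    assume "v \<noteq> w"
    then consider "v < w" | "w < v" by linarith
    then show False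
    proof cases
      case 1
      then have "v * exp v < w * exp w" using that by (intro mult_strict_mono) auto
      then show False using that w by simp
    next
      case 2
      then have "w * exp w < v * exp v" using w that by (intro mult_strict_mono) auto
      then show False using that w by simp
    qed
  qed
  ultimately show ?thesis using w by blast
qed

lemma Lambert_W_pos: "x > 0 \<Longrightarrow> Lambert_W x > 0"
  and Lambert_W_times_exp: "x > 0 \<Longrightarrow> Lambert_W x * exp (Lambert_W x) = x"
  using theI'[OF Lambert_W_ex1] unfolding Lambert_W_def by auto

definition Holder_mean :: "real \<Rightarrow> real \<Rightarrow> real \<Rightarrow> real" where
  "Holder_mean p r s =
     (if p = 0 then sqrt (r * s) else ((r powr p + s powr p) / 2) powr (1 / p))"

text \<open>The first conjunct in each definition says that \<open>f\<close> maps \<open>(0, \<infinity>)\<close> into itself.\<close>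

definition H_convex :: "real \<Rightarrow> real \<Rightarrow> (real \<Rightarrow> real) \<Rightarrow> bool" where
  "H_convex p q f \<longleftrightarrow>
     (\<forall>x>0. f x > 0) \<and>
     (\<forall>r>0. \<forall>s>0. f (Holder_mean p r s) \<le> Holder_mean q (f r) (f s))"

definition H_concave :: "real \<Rightarrow> real \<Rightarrow> (real \<Rightarrow> real) \<Rightarrow> bool" where
  "H_concave p q f \<longleftrightarrow>
     (\<forall>x>0. f x > 0) \<and>
     (\<forall>r>0. \<forall>s>0. f (Holder_mean p r s) \<ge> Holder_mean q (f r) (f s))"

definition strictly_H_convex :: "real \<Rightarrow> real \<Rightarrow> (real \<Rightarrow> real) \<Rightarrow> bool" where
  "strictly_H_convex p q f \<longleftrightarrow>
     H_convex p q f \<and>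
     (\<forall>r>0. \<forall>s>0. r \<noteq> s \<longrightarrow> f (Holder_mean p r s) < Holder_mean q (f r) (f s))"

definition strictly_H_concave :: "real \<Rightarrow> real \<Rightarrow> (real \<Rightarrow> real) \<Rightarrow> bool" where
  "strictly_H_concave p q f \<longleftrightarrow>
     H_concave p q f \<and>
     (\<forall>r>0. \<forall>s>0. r \<noteq> s \<longrightarrow> f (Holder_mean p r s) > Holder_mean q (f r) (f s))"

definition C :: "real \<Rightarrow> real" where
  "C p = - 2 * sqrt (- p) + 1"

definition D1 :: "(real \<times> real) set" where
  "D1 = {(p, q). p \<le> - 1 \<and> p \<le> q}"

definition D2 :: "(real \<times> real) set" where
  "D2 = {(p, q). - 1 < p \<and> p \<le> 0 \<and> C p \<le> q}"

definition D3 :: "(real \<times> real) set" where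
  "D3 = {(p, q). 0 \<le> p \<and> q \<le> p}"

end

(* Put \<phi>_p(x) = x^p / p, with \<phi>_0 = ln. Since \<phi>_p is increasing and turns H_p into
   the arithmetic mean, comparing W(H_p(x, y)) with H_q(W(x), W(y)) amounts to comparing
   B(m) with (B(u) + B(v)) / 2 at the point m where A(m) = (A(u) + A(v)) / 2; here u = W(x),
   v = W(y), A = \<phi>_q and B(w) = \<phi>_p(w e^w). This is decided by the monotonicity of
   B'/A' = w^(p-q) (1+w) e^(pw), whose derivative has the sign of the quadratic
   p z^2 + (1-q) z - 1 in z = w + 1 > 1. It is negative off at most one point when (p, q) lies
   in D1 \<union> D2, positive when (p, q) lies in D3, and otherwise it takes the opposite sign on
   an interval, which violates the respective inequality. *)

theory Submission
  imports Defs
begin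

section \<open>Power scales and Hoelder means\<close>

definition power_scale :: "real \<Rightarrow> real \<Rightarrow> real" where
  "power_scale p x = (if p = 0 then ln x else x powr p / p)"

text \<open>Dividing by \<open>p\<close> is what lets one formula cover every order, with
  \<open>ln\<close> as the case of order 0, and what keeps the scale increasing when
  \<open>p\<close> is negative.\<close>

lemma DERIV_power_scale:
  assumes "x > 0"
  shows "(power_scale p has_real_derivative x powr (p - 1)) (at x)"
proof (cases "p = 0")
  case True
  have "power_scale p = ln" using True by (auto simp: power_scale_def)
  moreover have "(ln has_real_derivative x powr (- 1)) (at x)"
    using assms by (auto intro!: derivative_eq_intros simp: powr_minus_divide divide_simps)
  ultimately show ?thesis using True by simp
next
  case False
  have "power_scale p = (\<lambda>x. x powr p / p)" using False by (auto simp: power_scale_def)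
  moreover have "((\<lambda>x. x powr p / p) has_real_derivative p * x powr (p - 1) / p) (at x)"
    using assms by (intro DERIV_cdivide has_real_derivative_powr)
  ultimately show ?thesis using False by simp
qed

lemma power_scale_strict_mono:
  assumes "0 < x" "x < y"
  shows "power_scale p x < power_scale p y"
proof (rule DERIV_pos_imp_increasing[OF assms(2)])
  fix t assume "x \<le> t" "t \<le> y"
  then show "\<exists>d. (power_scale p has_real_derivative d) (at t) \<and> 0 < d"
    using assms DERIV_power_scale[of t p] by (intro exI[of _ "t powr (p - 1)"]) auto
qed

lemma power_scale_less_iff:
  "0 < x \<Longrightarrow> 0 < y \<Longrightarrow> power_scale p x < power_scale p y \<longleftrightarrow> x < y"
  using power_scale_strict_mono[of x y p] power_scale_strict_mono[of y x p]
  by (cases x y rule: linorder_cases) auto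

lemma Holder_mean_pos: "r > 0 \<Longrightarrow> s > 0 \<Longrightarrow> Holder_mean p r s > 0"
  using add_pos_pos[of "r powr p" "s powr p"] by (simp add: Holder_mean_def)

lemma Holder_mean_commute: "Holder_mean p r s = Holder_mean p s r"
  by (simp add: Holder_mean_def mult.commute add.commute)

lemma Holder_mean_self: "r > 0 \<Longrightarrow> Holder_mean p r r = r"
  by (simp add: Holder_mean_def powr_powr)

lemma power_scale_Holder_mean:
  assumes "r > 0" "s > 0"
  shows "power_scale p (Holder_mean p r s) = (power_scale p r + power_scale p s) / 2"
proof (cases "p = 0")
  case True
  then show ?thesis
    using assms by (simp add: power_scale_def Holder_mean_def ln_sqrt ln_mult)
next
  case False
  have "r powr p + s powr p > 0" using assms by (simp add: add_pos_pos)
  then show ?thesis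
    using False by (simp add: power_scale_def Holder_mean_def powr_powr field_simps)
qed

text \<open>On the order-preserving power scale the mean is a midpoint. The midpoint comparison
  below needs the mean to be an interior point of the interval.\<close>

lemma Holder_mean_between:
  assumes "0 < r" "r < s"
  shows "r < Holder_mean p r s" "Holder_mean p r s < s"
proof -
  have less: "power_scale p r < power_scale p s" using power_scale_strict_mono assms by blast
  have pos: "0 < Holder_mean p r s" using Holder_mean_pos assms by simp
  have mid: "power_scale p (Holder_mean p r s) = (power_scale p r + power_scale p s) / 2"
    using power_scale_Holder_mean assms by simp
  show "r < Holder_mean p r s"
    using power_scale_less_iff[OF assms(1) pos, of p] less mid by simp
  show "Holder_mean p r s < s"
    using power_scale_less_iff[OF pos, of s p] assms less mid by simp
qed

section \<open>Monotonicity and midpoint comparison from derivatives\<close>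

lemma DERIV_pos_except_point_imp_increasing:
  fixes f :: "real \<Rightarrow> real"
  assumes "a < b"
    and der: "\<And>x. a \<le> x \<Longrightarrow> x \<le> b \<Longrightarrow> (f has_real_derivative f' x) (at x)"
    and pos: "\<And>x. a < x \<Longrightarrow> x < b \<Longrightarrow> x \<noteq> c \<Longrightarrow> f' x > 0"
  shows "f a < f b"
proof -
  \<comment> \<open>Only the open interval has to avoid \<open>c\<close>, so \<open>c\<close> may be
    the common endpoint of two pieces.\<close>
  have incr: "f s < f t" if "a \<le> s" "s < t" "t \<le> b" "c \<notin> {s<..<t}" for s t
  proof (rule DERIV_pos_imp_increasing_open[OF that(2)])
    fix x assume "s < x" "x < t"
    then show "\<exists>y. (f has_real_derivative y) (at x) \<and> 0 < y"
      using that der[of x] pos[of x] by force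
  next
    show "continuous_on {s..t} f"
      using that der by (intro DERIV_continuous_on[where D = f'])
        (auto intro: has_field_derivative_at_within)
  qed
  show ?thesis
  proof (cases "c \<in> {a<..<b}")
    case True
    then show ?thesis using incr[of a c] incr[of c b] by auto
  next
    case False
    then show ?thesis using incr[of a b] assms(1) by auto
  qed
qed

(* B - k(m) A has its strict minimum on [u, v] at m. *)
lemma midpoint_less_of_increasing_derivative_ratio:
  fixes A B k :: "real \<Rightarrow> real"
  assumes "u < m" "m < v" and mid: "A m = (A u + A v) / 2"
    and A: "\<And>x. u \<le> x \<Longrightarrow> x \<le> v \<Longrightarrow> (A has_real_derivative A' x) (at x)"
    and B: "\<And>x. u \<le> x \<Longrightarrow> x \<le> v \<Longrightarrow> (B has_real_derivative k x * A' x) (at x)"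
    and A'pos: "\<And>x. u \<le> x \<Longrightarrow> x \<le> v \<Longrightarrow> A' x > 0"
    and k: "\<And>x y. u \<le> x \<Longrightarrow> x < y \<Longrightarrow> y \<le> v \<Longrightarrow> k x < k y"
  shows "2 * B m < B u + B v"
proof -
  define h where "h = (\<lambda>x. B x - k m * A x)"
  have h: "(h has_real_derivative (k x - k m) * A' x) (at x)" if "u \<le> x" "x \<le> v" for x
    unfolding h_def using A[OF that] B[OF that]
    by (auto intro!: derivative_eq_intros simp: algebra_simps)
  have h_cont: "continuous_on {s..t} h" if "u \<le> s" "t \<le> v" for s t
    using that h by (intro DERIV_continuous_on[where D = "\<lambda>x. (k x - k m) * A' x"])
        (auto intro: has_field_derivative_at_within)
  have "h m < h u"
  proof (rule DERIV_neg_imp_decreasing_open[OF assms(1)])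
    fix x assume "u < x" "x < m"
    then show "\<exists>y. (h has_real_derivative y) (at x) \<and> y < 0"
      using assms(1,2) h[of x] k[of x m] A'pos[of x]
      by (intro exI[of _ "(k x - k m) * A' x"]) (auto simp: mult_neg_pos)
  qed (use h_cont assms in auto)
  moreover have "h m < h v"
  proof (rule DERIV_pos_imp_increasing_open[OF assms(2)])
    fix x assume "m < x" "x < v"
    then show "\<exists>y. (h has_real_derivative y) (at x) \<and> 0 < y"
      using assms(1,2) h[of x] k[of m x] A'pos[of x]
      by (intro exI[of _ "(k x - k m) * A' x"]) auto
  qed (use h_cont assms in auto)
  \<comment> \<open>The two inequalities are added; by \<open>mid\<close> the terms with factor
    \<open>k m\<close> cancel.\<close>
  ultimately show ?thesis
    using mid by (simp add: h_def field_simps)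
qed

section \<open>The inverse of W and the derivative ratio\<close>

lemma Lambert_W_eqI: "w > 0 \<Longrightarrow> Lambert_W (w * exp w) = w"
  unfolding Lambert_W_def using Lambert_W_ex1[of "w * exp w"]
  by (intro the1_equality) auto

lemma times_exp_strict_mono: "0 < v \<Longrightarrow> v < w \<Longrightarrow> v * exp v < w * exp (w :: real)"
  by (intro mult_strict_mono) auto

lemma Lambert_W_strict_mono:
  assumes "0 < x" "x < y"
  shows "Lambert_W x < Lambert_W y"
proof (rule ccontr)
  assume "\<not> Lambert_W x < Lambert_W y"
  then have "y \<le> x"
    using assms Lambert_W_pos[of y] Lambert_W_times_exp[of x] Lambert_W_times_exp[of y]
      times_exp_strict_mono[of "Lambert_W y" "Lambert_W x"]
    by (cases "Lambert_W x = Lambert_W y") auto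
  then show False using assms by simp
qed

definition derivative_ratio :: "real \<Rightarrow> real \<Rightarrow> real \<Rightarrow> real" where
  "derivative_ratio p q w = w powr (p - q) * (1 + w) * exp (p * w)"

definition sign_quadratic :: "real \<Rightarrow> real \<Rightarrow> real \<Rightarrow> real" where
  "sign_quadratic p q z = p * z\<^sup>2 + (1 - q) * z - 1"

lemma derivative_ratio_pos: "w > 0 \<Longrightarrow> derivative_ratio p q w > 0"
  by (simp add: derivative_ratio_def)

text \<open>The logarithmic derivative is (p - q)/w + 1/(1 + w) + p. Over the common denominator w
  (1 + w), its numerator is the quadratic at z = w + 1.\<close>

lemma DERIV_derivative_ratio:
  assumes "w > 0"
  shows "(derivative_ratio p q has_real_derivative
    derivative_ratio p q w / (w * (1 + w)) * sign_quadratic p q (w + 1)) (at w)"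
proof -
  have "((\<lambda>w. w powr (p - q) * (1 + w) * exp (p * w)) has_real_derivative
    ((p - q) * w powr (p - q - 1) * (1 + w) + w powr (p - q)) * exp (p * w)
      + w powr (p - q) * (1 + w) * (p * exp (p * w))) (at w)"
    using assms by (auto intro!: derivative_eq_intros simp: algebra_simps)
  moreover have "derivative_ratio p q = (\<lambda>w. w powr (p - q) * (1 + w) * exp (p * w))"
    by (auto simp: derivative_ratio_def)
  moreover have "w powr (p - q - 1) = w powr (p - q) / w"
    using assms by (simp add: powr_diff)
  \<comment> \<open>With the power and the exponential abstracted to \<open>P\<close> and
    \<open>E\<close>, the identity is rational in \<open>w\<close>.\<close>
  moreover have "((p - q) * (P / w) * (1 + w) + P) * E + P * (1 + w) * (p * E)
      = P * (1 + w) * E / (w * (1 + w)) * (p * (w + 1)\<^sup>2 + (1 - q) * (w + 1) - 1)" for P E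
    using assms by (simp add: divide_simps) (simp add: power2_eq_square algebra_simps)
  ultimately show ?thesis
    by (simp add: derivative_ratio_def sign_quadratic_def)
qed

text \<open>The chain rule gives w^(p-1) (1 + w) e^(p w). The factor w^(q-1), the derivative of
  \<open>power_scale q\<close>, is split off to match the shape \<open>k x * A' x\<close> of the
  midpoint comparison.\<close>

lemma DERIV_power_scale_times_exp:
  assumes "w > 0"
  shows "((\<lambda>w. power_scale p (w * exp w)) has_real_derivative
    derivative_ratio p q w * w powr (q - 1)) (at w)"
proof -
  have "((\<lambda>w. power_scale p (w * exp w)) has_real_derivative
    (w * exp w) powr (p - 1) * ((1 + w) * exp w)) (at w)"
    by (rule DERIV_chain2[of "power_scale p"])
      (use assms in \<open>auto intro!: DERIV_power_scale derivative_eq_intros simp: algebra_simps\<close>)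
  moreover have "(w * exp w) powr (p - 1) = w powr (p - q) * w powr (q - 1) * exp ((p - 1) * w)"
    using assms by (simp add: powr_mult powr_add[symmetric]) (simp add: powr_def)
  moreover have "exp (p * w) = exp ((p - 1) * w) * exp w"
    by (simp add: exp_add[symmetric] algebra_simps)
  then have "P * Q * exp ((p - 1) * w) * ((1 + w) * exp w) = P * (1 + w) * exp (p * w) * Q" for P Q
    by simp
  ultimately show ?thesis
    by (simp only: derivative_ratio_def)
qed

section \<open>From the sign of the quadratic to inequalities between means\<close>

lemma Lambert_W_Holder_mean_less_aux:
  assumes "0 < u" "u < v"
    and neg: "\<And>w. u < w \<Longrightarrow> w < v \<Longrightarrow> w \<noteq> c \<Longrightarrow> sign_quadratic p q (w + 1) < 0"
  shows "Lambert_W (Holder_mean p (u * exp u) (v * exp v)) < Holder_mean q u v"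
proof -
  define m where "m = Holder_mean q u v"
  have m: "u < m" "m < v" using Holder_mean_between assms by (auto simp: m_def)
  \<comment> \<open>The ratio is decreasing between \<open>u\<close> and \<open>v\<close>, so the
    midpoint comparison is applied to the negated function. The result is then carried back through
    the increasing maps \<open>power_scale p\<close> and \<open>Lambert_W\<close>.\<close>
  have "2 * - power_scale p (m * exp m) < - power_scale p (u * exp u) + - power_scale p (v * exp v)"
  proof (rule midpoint_less_of_increasing_derivative_ratio[OF m,
        where A = "power_scale q" and A' = "\<lambda>x. x powr (q - 1)"
          and k = "\<lambda>x. - derivative_ratio p q x"])
    show "power_scale q m = (power_scale q u + power_scale q v) / 2"
      using assms by (simp add: m_def power_scale_Holder_mean)
  next
    fix x assume "u \<le> x" "x \<le> v"
    then have "x > 0" using assms by simp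
    then show "(power_scale q has_real_derivative x powr (q - 1)) (at x)"
      by (rule DERIV_power_scale)
    show "((\<lambda>w. - power_scale p (w * exp w)) has_real_derivative
        - derivative_ratio p q x * x powr (q - 1)) (at x)"
      using DERIV_minus[OF DERIV_power_scale_times_exp[OF \<open>x > 0\<close>, of p q]] by simp
    show "0 < x powr (q - 1)" using \<open>x > 0\<close> by simp
  next
    fix x y assume xy: "u \<le> x" "x < y" "y \<le> v"
    show "- derivative_ratio p q x < - derivative_ratio p q y"
    proof (rule DERIV_pos_except_point_imp_increasing[OF xy(2), where c = c])
      fix t assume "x \<le> t" "t \<le> y"
      then have "t > 0" using xy assms by simp
      then show "((\<lambda>w. - derivative_ratio p q w) has_real_derivative
          - (derivative_ratio p q t / (t * (1 + t)) * sign_quadratic p q (t + 1))) (at t)"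
        by (intro DERIV_minus DERIV_derivative_ratio)
    next
      fix t assume t: "x < t" "t < y" "t \<noteq> c"
      then have "t > 0" "sign_quadratic p q (t + 1) < 0" using xy assms by auto
      then show "0 < - (derivative_ratio p q t / (t * (1 + t)) * sign_quadratic p q (t + 1))"
        using derivative_ratio_pos[of t p q] by (simp add: mult_pos_neg divide_neg_pos)
    qed
  qed
  then have "power_scale p (Holder_mean p (u * exp u) (v * exp v)) < power_scale p (m * exp m)"
    using assms by (simp add: power_scale_Holder_mean)
  then have "Holder_mean p (u * exp u) (v * exp v) < m * exp m"
    using assms m by (subst (asm) power_scale_less_iff) (auto intro!: Holder_mean_pos)
  then have "Lambert_W (Holder_mean p (u * exp u) (v * exp v)) < Lambert_W (m * exp m)"
    using assms by (intro Lambert_W_strict_mono Holder_mean_pos) auto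
  then show ?thesis using m assms by (simp add: Lambert_W_eqI m_def)
qed

text \<open>The mirror image of the previous argument, with an increasing ratio and hence no
  negation. No exceptional point occurs, since on \<open>D3\<close> the quadratic has no zero beyond
  1.\<close>

lemma Lambert_W_Holder_mean_greater_aux:
  assumes "0 < u" "u < v"
    and pos: "\<And>w. u < w \<Longrightarrow> w < v \<Longrightarrow> sign_quadratic p q (w + 1) > 0"
  shows "Lambert_W (Holder_mean p (u * exp u) (v * exp v)) > Holder_mean q u v"
proof -
  define m where "m = Holder_mean q u v"
  have m: "u < m" "m < v" using Holder_mean_between assms by (auto simp: m_def)
  have "2 * power_scale p (m * exp m) < power_scale p (u * exp u) + power_scale p (v * exp v)"
  proof (rule midpoint_less_of_increasing_derivative_ratio[OF m,
        where A = "power_scale q" and A' = "\<lambda>x. x powr (q - 1)" and k = "derivative_ratio p q"])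
    show "power_scale q m = (power_scale q u + power_scale q v) / 2"
      using assms by (simp add: m_def power_scale_Holder_mean)
  next
    fix x assume "u \<le> x" "x \<le> v"
    then have "x > 0" using assms by simp
    then show "(power_scale q has_real_derivative x powr (q - 1)) (at x)"
      by (rule DERIV_power_scale)
    show "((\<lambda>w. power_scale p (w * exp w)) has_real_derivative
        derivative_ratio p q x * x powr (q - 1)) (at x)"
      using \<open>x > 0\<close> by (rule DERIV_power_scale_times_exp)
    show "0 < x powr (q - 1)" using \<open>x > 0\<close> by simp
  next
    fix x y assume xy: "u \<le> x" "x < y" "y \<le> v"
    show "derivative_ratio p q x < derivative_ratio p q y"
    \<comment> \<open>The point \<open>x\<close> lies outside the open interval, so this choice
      excludes nothing.\<close>
    proof (rule DERIV_pos_except_point_imp_increasing[OF xy(2), where c = x])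
      fix t assume "x \<le> t" "t \<le> y"
      then have "t > 0" using xy assms by simp
      then show "(derivative_ratio p q has_real_derivative
          derivative_ratio p q t / (t * (1 + t)) * sign_quadratic p q (t + 1)) (at t)"
        by (rule DERIV_derivative_ratio)
    next
      fix t assume t: "x < t" "t < y"
      then have "t > 0" "sign_quadratic p q (t + 1) > 0" using xy assms by auto
      then show "0 < derivative_ratio p q t / (t * (1 + t)) * sign_quadratic p q (t + 1)"
        using derivative_ratio_pos[of t p q] by simp
    qed
  qed
  then have "power_scale p (m * exp m) < power_scale p (Holder_mean p (u * exp u) (v * exp v))"
    using assms by (simp add: power_scale_Holder_mean)
  then have "m * exp m < Holder_mean p (u * exp u) (v * exp v)"
    using assms m by (subst (asm) power_scale_less_iff) (auto intro!: Holder_mean_pos)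
  then have "Lambert_W (m * exp m) < Lambert_W (Holder_mean p (u * exp u) (v * exp v))"
    using assms m by (intro Lambert_W_strict_mono) auto
  then show ?thesis using m assms by (simp add: Lambert_W_eqI m_def)
qed

text \<open>The exception \<open>c\<close> allows for the boundary q = C(p), where the quadratic can
  touch zero at a double root. In the variable w = z - 1 it becomes \<open>c - 1\<close>.\<close>

lemma strictly_H_convex_Lambert_WI:
  assumes neg: "\<And>z. z > 1 \<Longrightarrow> z \<noteq> c \<Longrightarrow> sign_quadratic p q z < 0"
  shows "strictly_H_convex p q Lambert_W"
proof -
  have less: "Lambert_W (Holder_mean p r s) < Holder_mean q (Lambert_W r) (Lambert_W s)"
    if "0 < r" "r < s" for r s
    using Lambert_W_Holder_mean_less_aux[of "Lambert_W r" "Lambert_W s" "c - 1" p q]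
      that neg Lambert_W_strict_mono[of r s] Lambert_W_pos[of r] Lambert_W_times_exp[of r]
      Lambert_W_times_exp[of s] by auto
  have strict: "Lambert_W (Holder_mean p r s) < Holder_mean q (Lambert_W r) (Lambert_W s)"
    if "r > 0" "s > 0" "r \<noteq> s" for r s
    using that less[of r s] less[of s r] Holder_mean_commute[of p r s]
      Holder_mean_commute[of q "Lambert_W r" "Lambert_W s"] by (cases r s rule: linorder_cases) auto
  have "Lambert_W (Holder_mean p r s) \<le> Holder_mean q (Lambert_W r) (Lambert_W s)"
    if "r > 0" "s > 0" for r s
    using that strict[of r s] by (cases "r = s") (auto simp: Holder_mean_self Lambert_W_pos)
  then show ?thesis
    using strict by (auto simp: strictly_H_convex_def H_convex_def Lambert_W_pos)
qed

lemma strictly_H_concave_Lambert_WI: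
  assumes pos: "\<And>z. z > 1 \<Longrightarrow> sign_quadratic p q z > 0"
  shows "strictly_H_concave p q Lambert_W"
proof -
  have less: "Lambert_W (Holder_mean p r s) > Holder_mean q (Lambert_W r) (Lambert_W s)"
    if "0 < r" "r < s" for r s
    using Lambert_W_Holder_mean_greater_aux[of "Lambert_W r" "Lambert_W s" p q]
      that pos Lambert_W_strict_mono[of r s] Lambert_W_pos[of r] Lambert_W_times_exp[of r]
      Lambert_W_times_exp[of s] by auto
  have strict: "Lambert_W (Holder_mean p r s) > Holder_mean q (Lambert_W r) (Lambert_W s)"
    if "r > 0" "s > 0" "r \<noteq> s" for r s
    using that less[of r s] less[of s r] Holder_mean_commute[of p r s]
      Holder_mean_commute[of q "Lambert_W r" "Lambert_W s"] by (cases r s rule: linorder_cases) auto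
  have "Lambert_W (Holder_mean p r s) \<ge> Holder_mean q (Lambert_W r) (Lambert_W s)"
    if "r > 0" "s > 0" for r s
    using that strict[of r s] by (cases "r = s") (auto simp: Holder_mean_self Lambert_W_pos)
  then show ?thesis
    using strict by (auto simp: strictly_H_concave_def H_concave_def Lambert_W_pos)
qed

section \<open>Failure of the inequalities at a point of the wrong sign\<close>

lemma positive_right_neighbourhood:
  fixes f :: "real \<Rightarrow> real"
  assumes "isCont f a" "f a > 0"
  obtains b where "a < b" "\<And>x. a < x \<Longrightarrow> x < b \<Longrightarrow> f x > 0"
proof -
  have "(f \<longlongrightarrow> f a) (at_right a)"
    using assms(1) by (auto simp: isCont_def intro: filterlim_at_withinI tendsto_within_subset)
  then have "\<forall>\<^sub>F x in at_right a. f x > 0"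
    using assms(2) by (rule order_tendstoD)
  then show ?thesis
    using that by (auto simp: eventually_at_right_field)
qed

text \<open>One point of the wrong sign refutes even the non-strict inequality: by continuity the
  sign persists on a short interval to its right, where the opposite strict inequality
  holds.\<close>

lemma not_H_convex_Lambert_W:
  assumes "z > 1" "sign_quadratic p q z > 0"
  shows "\<not> H_convex p q Lambert_W"
proof
  assume convex: "H_convex p q Lambert_W"
  define u where "u = z - 1"
  have "isCont (\<lambda>w. sign_quadratic p q (w + 1)) u"
    unfolding sign_quadratic_def by (intro continuous_intros)
  then obtain v where v: "u < v" "\<And>w. u < w \<Longrightarrow> w < v \<Longrightarrow> sign_quadratic p q (w + 1) > 0"
    using positive_right_neighbourhood[of u "\<lambda>w. sign_quadratic p q (w + 1)"] assms
    by (auto simp: u_def)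
  have "u > 0" using assms by (simp add: u_def)
  then have "Lambert_W (Holder_mean p (u * exp u) (v * exp v)) > Holder_mean q u v"
    using v by (intro Lambert_W_Holder_mean_greater_aux) auto
  moreover have "u * exp u > 0" "v * exp v > 0" using \<open>u > 0\<close> v by auto
  then have "Lambert_W (Holder_mean p (u * exp u) (v * exp v))
      \<le> Holder_mean q (Lambert_W (u * exp u)) (Lambert_W (v * exp v))"
    using convex unfolding H_convex_def by blast
  ultimately show False using \<open>u > 0\<close> v by (simp add: Lambert_W_eqI)
qed

lemma not_H_concave_Lambert_W:
  assumes "z > 1" "sign_quadratic p q z < 0"
  shows "\<not> H_concave p q Lambert_W"
proof
  assume concave: "H_concave p q Lambert_W"
  define u where "u = z - 1"
  have "isCont (\<lambda>w. - sign_quadratic p q (w + 1)) u"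
    unfolding sign_quadratic_def by (intro continuous_intros)
  then obtain v where v: "u < v" "\<And>w. u < w \<Longrightarrow> w < v \<Longrightarrow> sign_quadratic p q (w + 1) < 0"
    using positive_right_neighbourhood[of u "\<lambda>w. - sign_quadratic p q (w + 1)"] assms
    by (auto simp: u_def)
  have "u > 0" using assms by (simp add: u_def)
  then have "Lambert_W (Holder_mean p (u * exp u) (v * exp v)) < Holder_mean q u v"
    \<comment> \<open>The endpoint \<open>u\<close> serves as a harmless exceptional point.\<close>
    using v by (intro Lambert_W_Holder_mean_less_aux[where c = u]) auto
  moreover have "u * exp u > 0" "v * exp v > 0" using \<open>u > 0\<close> v by auto
  then have "Lambert_W (Holder_mean p (u * exp u) (v * exp v))
      \<ge> Holder_mean q (Lambert_W (u * exp u)) (Lambert_W (v * exp v))"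
    using concave unfolding H_concave_def by blast
  ultimately show False using \<open>u > 0\<close> v by (simp add: Lambert_W_eqI)
qed

section \<open>Sign of the quadratic on the parameter regions\<close>

lemma sign_quadratic_eq: "sign_quadratic p q z = (p - q) * z + (p * z + 1) * (z - 1)"
  by (simp add: sign_quadratic_def power2_eq_square algebra_simps)

text \<open>For p \<le> -1 both terms of \<open>sign_quadratic_eq\<close> have the right sign beyond
  z = 1. For larger p the second term may be positive, and completing the square takes over.\<close>

lemma sign_quadratic_neg:
  assumes "(p, q) \<in> D1 \<union> D2"
  obtains c where "\<And>z. z > 1 \<Longrightarrow> z \<noteq> c \<Longrightarrow> sign_quadratic p q z < 0"
proof (cases "p \<le> - 1")
  case True
  have "p \<le> q" using True assms by (auto simp: D1_def D2_def)
  have "sign_quadratic p q z < 0" if "z > 1" for z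
  proof -
    have "(p - q) * z \<le> 0" using \<open>p \<le> q\<close> that by (simp add: mult_nonpos_nonneg)
    moreover have "p * z \<le> - 1 * z" using True that by (intro mult_right_mono) auto
    then have "p * z + 1 < 0" using that by linarith
    then have "(p * z + 1) * (z - 1) < 0" using that by (simp add: mult_neg_pos)
    ultimately show ?thesis by (simp add: sign_quadratic_eq)
  qed
  then show ?thesis using that by blast
next
  case False
  define s where "s = sqrt (- p)"
  have p: "- 1 < p" "p \<le> 0" and q: "1 - 2 * s \<le> q"
    using False assms by (auto simp: D1_def D2_def C_def s_def)
  have s: "p = - s\<^sup>2" using p by (simp add: s_def)
  \<comment> \<open>The excluded point is the zero of the square below. For s = 0 division gives
    \<open>1 / s = 0\<close>, so nothing beyond 1 is excluded.\<close>
  have "sign_quadratic p q z < 0" if "z > 1" "z \<noteq> 1 / s" for z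
  proof -
    \<comment> \<open>After completing the square the remaining linear coefficient is C(p) - q,
      which explains the form of \<open>C\<close>.\<close>
    have "sign_quadratic p q z = - (s * z - 1)\<^sup>2 + (1 - 2 * s - q) * z"
      by (simp add: sign_quadratic_def s power2_eq_square algebra_simps)
    moreover have "(1 - 2 * s - q) * z \<le> 0"
      using q that by (simp add: mult_nonpos_nonneg)
    moreover have "s * z \<noteq> 1" using that by (cases "s = 0") (auto simp: field_simps)
    then have "(s * z - 1)\<^sup>2 > 0" by simp
    ultimately show ?thesis by linarith
  qed
  then show ?thesis using that by blast
qed

text \<open>In \<open>sign_quadratic_eq\<close> the first term is nonnegative and the second is
  strictly positive.\<close>

lemma sign_quadratic_pos:
  assumes "(p, q) \<in> D3" "z > 1"
  shows "sign_quadratic p q z > 0"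
proof -
  have "0 \<le> p" "q \<le> p" using assms by (auto simp: D3_def)
  then have "(p - q) * z \<ge> 0" "(p * z + 1) * (z - 1) > 0"
    using assms by (auto intro!: mult_pos_pos add_nonneg_pos)
  then show ?thesis by (simp add: sign_quadratic_eq)
qed

lemma sign_quadratic_pos_exists:
  assumes "(p, q) \<notin> D1 \<union> D2"
  obtains z where "z > 1" "sign_quadratic p q z > 0"
proof -
  have fact: "sign_quadratic p q z = z * (p * z + 1 - q) - 1" for z
    by (simp add: sign_quadratic_def power2_eq_square algebra_simps)
  consider "p > 0" | "p \<le> - 1" "q < p" | "p = 0" "q < 1" | "- 1 < p" "p < 0" "q < C p"
    using assms by (fastforce simp: D1_def D2_def C_def)
  then show ?thesis
  proof cases
    case 1
    \<comment> \<open>Chosen so that p z absorbs q: the bracket in \<open>fact\<close> is at least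
      1, and the value at least z - 1.\<close>
    define z where "z = 2 + \<bar>q\<bar> / p"
    have "\<bar>q\<bar> / p \<ge> 0" using 1 by simp
    then have z: "z > 1" by (simp add: z_def)
    have "p * z = 2 * p + \<bar>q\<bar>" using 1 by (simp add: z_def field_simps)
    then have "p * z + 1 - q \<ge> 1" using 1 by linarith
    then have "z * 1 \<le> z * (p * z + 1 - q)" using z by (intro mult_left_mono) auto
    then show ?thesis using z that[of z] unfolding fact by linarith
  next
    case 2
    \<comment> \<open>The value at 1 is the positive gap p - q. This z makes p (z - 1) consume only
      half of it.\<close>
    define z where "z = 1 + (p - q) / (- 2 * p)"
    have "(p - q) / (- 2 * p) > 0" using 2 by (intro divide_pos_pos) auto
    then have z: "z > 1" by (simp add: z_def)
    have "p * (z - 1) = - (p - q) / 2" using 2 by (simp add: z_def field_simps)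
    then have "(p - q) + p * (z - 1) > 0" using 2 by (simp add: field_simps)
    then have "z * ((p - q) + p * (z - 1)) > 0" using z by simp
    moreover have "sign_quadratic p q z = z * ((p - q) + p * (z - 1)) + (z - 1)"
      by (simp add: sign_quadratic_eq algebra_simps)
    ultimately show ?thesis using z that[of z] by simp
  next
    case 3
    \<comment> \<open>For p = 0 the quadratic is linear with root 1 / (1 - q); this z lies beyond
      both 1 and that root.\<close>
    define z where "z = 1 + 2 / (1 - q)"
    have "z > 1" using 3 by (simp add: z_def)
    moreover have "z * (1 - q) = (1 - q) + 2" using 3 by (simp add: z_def divide_simps)
    then have "z * (1 - q) > 1" using 3 by linarith
    ultimately show ?thesis using that[of z] 3 unfolding fact by simp
  next
    case 4
    define s where "s = sqrt (- p)"
    have s: "p = - s\<^sup>2" "s > 0" "s < 1" "q < 1 - 2 * s"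
      using 4 by (auto simp: s_def C_def real_sqrt_lt_1_iff)
    \<comment> \<open>At \<open>1 / s\<close> the completed square vanishes and only (C(p) - q) z is
      left; the point exceeds 1 because p > -1.\<close>
    have "sign_quadratic p q (1 / s) = (1 - 2 * s - q) / s"
      using s by (simp add: sign_quadratic_def power2_eq_square field_simps)
    then show ?thesis using that[of "1 / s"] s by simp
  qed
qed

lemma sign_quadratic_neg_exists:
  assumes "(p, q) \<notin> D3"
  obtains z where "z > 1" "sign_quadratic p q z < 0"
proof (cases "p < 0")
  case True
  \<comment> \<open>Now p z outweighs 1 - q, so the value is at most -1.\<close>
  define z where "z = 2 + \<bar>1 - q\<bar> / (- p)"
  have "\<bar>1 - q\<bar> / (- p) \<ge> 0" using True by (intro divide_nonneg_pos) auto
  then have z: "z > 1" by (simp add: z_def)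
  have "p * z = 2 * p - \<bar>1 - q\<bar>" using True by (simp add: z_def field_simps)
  then have "p * z + 1 - q \<le> 0" using True by linarith
  then have "z * (p * z + 1 - q) \<le> 0" using z by (simp add: mult_nonneg_nonpos)
  moreover have "sign_quadratic p q z = z * (p * z + 1 - q) - 1"
    by (simp add: sign_quadratic_def power2_eq_square algebra_simps)
  ultimately show ?thesis using z that[of z] by simp
next
  case False
  then have p: "0 \<le> p" "p < q" using assms by (auto simp: D3_def)
  \<comment> \<open>The value at 1 is p - q < 0, and \<open>e\<close> is a small step to the right
    of 1. The bound 1 gives p e \<le> p; the quotient keeps the growth (1 + p + p e) e within q - p,
    and the term -(q - p) e gives strictness.\<close>
  define e where "e = min 1 ((q - p) / (1 + 2 * p))"
  have e: "0 < e" "e \<le> 1" using p by (auto simp: e_def)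
  have "e \<le> (q - p) / (1 + 2 * p)" by (simp add: e_def)
  then have e_le: "e * (1 + 2 * p) \<le> q - p" using p by (simp add: pos_le_divide_eq)
  have "p * e \<le> p" using p e by (simp add: mult_left_le)
  then have "(1 + p + p * e) * e \<le> (1 + 2 * p) * e" using e by (intro mult_right_mono) auto
  moreover have "(q - p) * e > 0" using p e by simp
  moreover have "sign_quadratic p q (1 + e) = (1 + p + p * e) * e - (q - p) * e - (q - p)"
    by (simp add: sign_quadratic_eq algebra_simps)
  ultimately have "sign_quadratic p q (1 + e) < 0" using e_le by (simp add: mult.commute)
  then show ?thesis using e that[of "1 + e"] by simp
qed

section \<open>Characterisations and the special means\<close>

lemma strictly_H_convex_Lambert_W_iff:
  "strictly_H_convex p q Lambert_W \<longleftrightarrow> (p, q) \<in> D1 \<union> D2"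
  using sign_quadratic_neg strictly_H_convex_Lambert_WI sign_quadratic_pos_exists
    not_H_convex_Lambert_W strictly_H_convex_def by metis

lemma strictly_H_concave_Lambert_W_iff:
  "strictly_H_concave p q Lambert_W \<longleftrightarrow> (p, q) \<in> D3"
  using sign_quadratic_pos strictly_H_concave_Lambert_WI sign_quadratic_neg_exists
    not_H_concave_Lambert_W strictly_H_concave_def by metis

lemma strictly_H_convexD:
  assumes "strictly_H_convex p q f" "x > 0" "y > 0"
  shows "f (Holder_mean p x y) \<le> Holder_mean q (f x) (f y)"
    and "f (Holder_mean p x y) = Holder_mean q (f x) (f y) \<longleftrightarrow> x = y"
  using assms
  by (fastforce simp: strictly_H_convex_def H_convex_def Holder_mean_self)+

lemma strictly_H_concaveD:
  assumes "strictly_H_concave p q f" "x > 0" "y > 0"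
  shows "Holder_mean q (f x) (f y) \<le> f (Holder_mean p x y)"
    and "Holder_mean q (f x) (f y) = f (Holder_mean p x y) \<longleftrightarrow> x = y"
  using assms
  by (fastforce simp: strictly_H_concave_def H_concave_def Holder_mean_self)+

lemma Holder_mean_0: "Holder_mean 0 x y = sqrt (x * y)"
  by (simp add: Holder_mean_def)

lemma Holder_mean_1: "x > 0 \<Longrightarrow> y > 0 \<Longrightarrow> Holder_mean 1 x y = 1 / 2 * (x + y)"
  by (simp add: Holder_mean_def)

lemma Holder_mean_minus_1: "x > 0 \<Longrightarrow> y > 0 \<Longrightarrow> Holder_mean (- 1) x y = 2 * x * y / (x + y)"
  by (simp add: Holder_mean_def powr_minus add_pos_pos) (simp add: field_simps)

text \<open>The mean of order -1/4 is the fourth power of the harmonic mean of the fourth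
  roots.\<close>

lemma Holder_mean_minus_quarter:
  assumes "x > 0" "y > 0"
  shows "Holder_mean (- 1 / 4) x y = (2 * root 4 (x * y) / (root 4 x + root 4 y)) ^ 4"
proof -
  define a b where "a = root 4 x" and "b = root 4 y"
  have ab: "a > 0" "b > 0" using assms by (auto simp: a_def b_def)
  have powr: "t powr - (1 / 4) = 1 / root 4 t" if "t > 0" for t :: real
    using that root_powr_inverse[of 4 t] powr_minus[of t "1 / 4"] by (simp add: divide_simps)
  have "Holder_mean (- 1 / 4) x y = ((1 / a + 1 / b) / 2) powr - 4"
    using assms by (simp add: Holder_mean_def powr a_def b_def)
  also have "(1 / a + 1 / b) / 2 = (a + b) / (2 * a * b)"
    using ab by (simp add: field_simps)
  also have "\<dots> powr - 4 = inverse (((a + b) / (2 * a * b)) ^ 4)"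
    using ab powr_realpow[of "(a + b) / (2 * a * b)" 4] by (simp add: powr_minus add_pos_pos)
  also have "\<dots> = (2 * (a * b) / (a + b)) ^ 4"
    by (simp add: power_inverse[symmetric] mult.assoc)
  finally show ?thesis by (simp add: a_def b_def real_root_mult)
qed

theorem theorem1p1:
  "(\<forall>p q. (strictly_H_convex p q Lambert_W \<longleftrightarrow> (p, q) \<in> D1 \<union> D2) \<and>
          (strictly_H_concave p q Lambert_W \<longleftrightarrow> (p, q) \<in> D3)) \<and>
   (\<forall>x>0. \<forall>y>0.
      Lambert_W (2 * x * y / (x + y))
        \<le> 2 * Lambert_W x * Lambert_W y / (Lambert_W x + Lambert_W y) \<and>
      (Lambert_W (2 * x * y / (x + y))
        = 2 * Lambert_W x * Lambert_W y / (Lambert_W x + Lambert_W y) \<longleftrightarrow> x = y) \<and>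
      Lambert_W ((2 * root 4 (x * y) / (root 4 x + root 4 y)) ^ 4)
        \<le> sqrt (Lambert_W x * Lambert_W y) \<and>
      (Lambert_W ((2 * root 4 (x * y) / (root 4 x + root 4 y)) ^ 4)
        = sqrt (Lambert_W x * Lambert_W y) \<longleftrightarrow> x = y) \<and>
      sqrt (Lambert_W x * Lambert_W y) \<le> Lambert_W (sqrt (x * y)) \<and>
      (sqrt (Lambert_W x * Lambert_W y) = Lambert_W (sqrt (x * y)) \<longleftrightarrow> x = y) \<and>
      Lambert_W (sqrt (x * y)) \<le> 1 / 2 * (Lambert_W x + Lambert_W y) \<and>
      (Lambert_W (sqrt (x * y)) = 1 / 2 * (Lambert_W x + Lambert_W y) \<longleftrightarrow> x = y))"
proof -
  \<comment> \<open>The four inequalities come from the pairs (-1, -1), (-1/4, 0), (0, 0) and (0,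
    1).\<close>
  have "strictly_H_convex (- 1) (- 1) Lambert_W"
    unfolding strictly_H_convex_Lambert_W_iff by (simp add: D1_def)
  note harmonic = strictly_H_convexD[OF this]
  \<comment> \<open>The order -1/4 is where C(p) reaches 0, the order of the geometric mean. The
    pair lies on the boundary of \<open>D2\<close>, with a double root at z = 2.\<close>
  have "C (- 1 / 4) = 0"
    using real_sqrt_divide[of 1 4] by (simp add: C_def)
  then have "strictly_H_convex (- 1 / 4) 0 Lambert_W"
    unfolding strictly_H_convex_Lambert_W_iff by (simp add: D2_def)
  note quarter = strictly_H_convexD[OF this]
  have "strictly_H_concave 0 0 Lambert_W"
    unfolding strictly_H_concave_Lambert_W_iff by (simp add: D3_def)
  note geometric = strictly_H_concaveD[OF this]
  have "strictly_H_convex 0 1 Lambert_W"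
    unfolding strictly_H_convex_Lambert_W_iff by (simp add: D2_def C_def)
  note arithmetic = strictly_H_convexD[OF this]
  show ?thesis
  proof (intro conjI[OF allI[OF allI] allI[OF impI[OF allI[OF impI]]]], goal_cases)
    case (1 p q)
    show ?case
      using strictly_H_convex_Lambert_W_iff strictly_H_concave_Lambert_W_iff by simp
  next
    case (2 x y)
    then have W: "Lambert_W x > 0" "Lambert_W y > 0" by (simp_all add: Lambert_W_pos)
    show ?case
      using harmonic[OF 2, unfolded Holder_mean_minus_1[OF 2] Holder_mean_minus_1[OF W]]
        quarter[OF 2, unfolded Holder_mean_minus_quarter[OF 2] Holder_mean_0]
        geometric[OF 2, unfolded Holder_mean_0]
        arithmetic[OF 2, unfolded Holder_mean_0 Holder_mean_1[OF W]]
      by blast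
  qed
qed

end
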